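(* Let $\mathcal{V}$ be a finite-dimensional vector space over a field of characteristic $\ell \ge 5$, and let $A$ be a unipotent linear operator on $\mathcal{V}$. Let $k$ be an integer with $2 \le k \le \dim(\mathcal{V})-2$, and suppose $(A-1)^{\ell-2} \ne 0$. Then $(\wedge^k(A)-1)^{\ell-1} \ne 0$.
   Context: $\wedge^k(A)$ denotes the linear operator on the $k$-th exterior power $\wedge^k(\mathcal{V})$ induced by $A$. *)

theory Defs
  imports "Jordan_Normal_Form.Determinant" "Jordan_Normal_Form.DL_Submatrix"
begin

text \<open>The k-element subsets of the index set {0..<n}, each written as a strictly
  increasing list; this list enumerates the standard basis
  e_{i_1} wedge ... wedge e_{i_k} (i_1 < ... < i_k) of the k-th exterior power.\<close>
definition k_subsets :: "nat \<Rightarrow> nat \<Rightarrow> nat list list" where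
  "k_subsets n k = filter (sorted_wrt (<)) (List.n_lists k [0..<n])"

text \<open>The matrix of the induced operator on the k-th exterior power (w.r.t. the above
  standard basis): its (S,T) entry is the k x k minor of A with rows S and columns T
  (Cauchy-Binet / compound matrix).\<close>
definition ext_power :: "nat \<Rightarrow> 'a::comm_ring_1 mat \<Rightarrow> 'a mat" where
  "ext_power k A =
     (let B = k_subsets (dim_row A) k; N = length B in
      mat N N (\<lambda>(i,j). det (submatrix A (set (B ! i)) (set (B ! j)))))"

definition unipotent_mat :: "'a::ring_1 mat \<Rightarrow> bool" where
  "unipotent_mat A \<longleftrightarrow> (\<exists>m. (A - 1\<^sub>m (dim_row A)) ^\<^sub>m m = 0\<^sub>m (dim_row A) (dim_row A))"

end

theory Submission
  imports Defs "HOL-Computational_Algebra.Primes"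
begin

text \<open>
  Write p for the characteristic and N = A - 1. By nilpotency there is a functional f with
  f N^(p-1) = 0 and f N^(p-2) v = 1 for some v. Then f A^p = f, and the functionals
  f, f A, ..., f A^(p-2) are linearly independent; choose vectors dual to them, and extend both
  families by further biorthogonal pairs. Wedging f A, ..., f A^k' (2 <= k' <= p-3) with k - k'
  of the extra functionals, and likewise for the vectors, gives a functional u and a vector w of
  the k-th exterior power. If i = 1, ..., p-1, then one of the exponents 1+i, ..., k'+i lies
  strictly between k' and p-1 or equals p, so the matrix whose determinant is u(A^i w) has a zero
  row; for i = 0 it is the identity. Hence u((X - 1)^(p-1) w) = 1 up to sign, where X is the
  operator induced by A.
\<close>

section \<open>The Cauchy-Binet formula\<close>

lemma set_k_subsets:
  "L \<in> set (k_subsets n k) \<longleftrightarrow> length L = k \<and> set L \<subseteq> {0..<n} \<and> sorted_wrt (<) L"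
  by (auto simp: k_subsets_def set_n_lists)

lemma distinct_k_subsets: "distinct (k_subsets n k)"
  by (simp add: k_subsets_def distinct_n_lists)

text \<open>\<open>pick\<close> is tied to counting: an element of the set with exactly i smaller
  elements is the i-th one (\<open>pick_card_in_set\<close>). In an increasing list the entries
  below L ! i are precisely the first i.\<close>

lemma pick_set_sorted:
  assumes "sorted_wrt (<) L" "i < length L"
  shows "pick (set L) i = L ! i"
proof -
  have d: "distinct L" using assms(1) strict_sorted_iff by blast
  have "{a \<in> set L. a < L ! i} = (!) L ` {0..<i}"
  proof (intro equalityI subsetI)
    fix x assume "x \<in> {a \<in> set L. a < L ! i}"
    then obtain j where j: "j < length L" "x = L ! j" "L ! j < L ! i"
      by (auto simp: in_set_conv_nth)
    have "j < i"
    proof (rule ccontr)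
      assume "\<not> j < i"
      then have "L ! i \<le> L ! j"
        using assms(1) j(1) by (cases "i = j") (auto simp: sorted_wrt_iff_nth_less intro: less_imp_le)
      with j(3) show False by simp
    qed
    with j show "x \<in> (!) L ` {0..<i}" by simp
  next
    fix x assume "x \<in> (!) L ` {0..<i}"
    then show "x \<in> {a \<in> set L. a < L ! i}"
      using assms by (auto simp: sorted_wrt_iff_nth_less)
  qed
  moreover have "inj_on ((!) L) {0..<i}"
    using d assms(2) by (auto simp: inj_on_def nth_eq_iff_index_eq)
  ultimately have "card {a \<in> set L. a < L ! i} = i"
    by (simp add: card_image)
  then show ?thesis using pick_card_in_set[of "L ! i" "set L"] assms(2) by simp
qed

text \<open>Bridge from the set-indexed minors in \<open>ext_power\<close> to minors indexed by
  increasing lists, the form in which Cauchy-Binet is stated.\<close>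

lemma submatrix_sorted_lists:
  assumes "A \<in> carrier_mat n n" "L \<in> set (k_subsets n k)" "M \<in> set (k_subsets n k)"
  shows "submatrix A (set L) (set M) = mat k k (\<lambda>(a, b). A $$ (L ! a, M ! b))"
proof -
  have c: "card {i. i < n \<and> i \<in> set K} = k" if "K \<in> set (k_subsets n k)" for K
  proof -
    have "{i. i < n \<and> i \<in> set K} = set K" using that by (auto simp: set_k_subsets)
    moreover have "distinct K" using that strict_sorted_iff by (auto simp: set_k_subsets)
    ultimately show ?thesis using that by (simp add: distinct_card set_k_subsets)
  qed
  show ?thesis using assms
    by (intro eq_matI) (auto simp: submatrix_def c pick_set_sorted set_k_subsets)
qed

text \<open>Each row of F * G is a linear combination of the rows of G, and det is multilinear in
  the rows; f selects one row of G for every row of the product. Fixing f i = i outside {0..<k}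
  leaves only finitely many f.\<close>

lemma det_mult_eq_sum_functions:
  fixes F G :: "'a::comm_ring_1 mat"
  assumes F: "F \<in> carrier_mat k n" and G: "G \<in> carrier_mat n k"
  shows "det (F * G) = (\<Sum>f | (\<forall>i\<in>{0..<k}. f i \<in> {0..<n}) \<and> (\<forall>i. i \<notin> {0..<k} \<longrightarrow> f i = i).
    (\<Prod>i = 0..<k. F $$ (i, f i)) * det (mat k k (\<lambda>(i, j). G $$ (f i, j))))"
proof -
  have "det (F * G) = (\<Sum>f | (\<forall>i\<in>{0..<k}. f i \<in> {0..<n}) \<and> (\<forall>i. i \<notin> {0..<k} \<longrightarrow> f i = i).
      det (mat\<^sub>r k k (\<lambda>i. F $$ (i, f i) \<cdot>\<^sub>v row G (f i))))"
    unfolding mat_mul_finsum_alt[OF F G]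
    by (rule det_linear_rows_sum, insert G, auto)
  also have "\<dots> = (\<Sum>f | (\<forall>i\<in>{0..<k}. f i \<in> {0..<n}) \<and> (\<forall>i. i \<notin> {0..<k} \<longrightarrow> f i = i).
      (\<Prod>i = 0..<k. F $$ (i, f i)) * det (mat\<^sub>r k k (\<lambda>i. row G (f i))))"
    by (intro sum.cong refl det_rows_mul) (insert G, auto)
  also have "\<dots> = (\<Sum>f | (\<forall>i\<in>{0..<k}. f i \<in> {0..<n}) \<and> (\<forall>i. i \<notin> {0..<k} \<longrightarrow> f i = i).
      (\<Prod>i = 0..<k. F $$ (i, f i)) * det (mat k k (\<lambda>(i, j). G $$ (f i, j))))"
  proof (intro sum.cong refl arg_cong[where f = "\<lambda>x. _ * det x"], goal_cases)
    case (1 f)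
    then show ?case using G by (intro eq_matI) auto
  qed
  finally show ?thesis .
qed

text \<open>An injective f factors uniquely as a permutation of the positions followed by the
  increasing enumeration of its image: the image determines L, and L has no repetitions, so p can be
  read off.\<close>

lemma bij_betw_sorted_list_permutation:
  "bij_betw (\<lambda>(L, p) i. if i < k then L ! p i else i)
     (set (k_subsets n k) \<times> {p. p permutes {0..<k}})
     {f. (\<forall>i\<in>{0..<k}. f i \<in> {0..<n}) \<and> (\<forall>i. i \<notin> {0..<k} \<longrightarrow> f i = i) \<and> inj_on f {0..<k}}"
    (is "bij_betw ?h ?D ?R")
  unfolding bij_betw_def
proof
  have nth: "L ! a = L ! b \<longleftrightarrow> a = b" if "L \<in> set (k_subsets n k)" "a < k" "b < k" for L a b
    using that strict_sorted_iff[of L] by (auto simp: set_k_subsets nth_eq_iff_index_eq)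
  have img: "?h (L, p) ` {0..<k} = set L" if "L \<in> set (k_subsets n k)" "p permutes {0..<k}" for L p
  proof -
    have "?h (L, p) ` {0..<k} = (!) L ` p ` {0..<k}" by (auto simp: image_image)
    also have "\<dots> = set L"
      using that(1) unfolding permutes_image[OF that(2)] set_k_subsets
      by (auto simp: set_conv_nth)
    finally show ?thesis .
  qed
  show "inj_on ?h ?D"
  proof (rule inj_onI, clarify)
    fix L p M q
    assume L: "L \<in> set (k_subsets n k)" and M: "M \<in> set (k_subsets n k)"
      and p: "p permutes {0..<k}" and q: "q permutes {0..<k}"
      and eq: "(\<lambda>i. if i < k then L ! p i else i) = (\<lambda>i. if i < k then M ! q i else i)"
    have "set L = set M" using img[OF L p] img[OF M q] eq by simp
    then have LM: "L = M" using L M strict_sorted_equal by (auto simp: set_k_subsets)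
    have "p i = q i" for i
    proof (cases "i < k")
      case True
      then have "L ! p i = L ! q i" using fun_cong[OF eq, of i] LM by simp
      then show ?thesis
        using nth[OF L] permutes_in_image[OF p, of i] permutes_in_image[OF q, of i] True by auto
    next
      case False
      then show ?thesis using permutes_not_in[OF p] permutes_not_in[OF q] by simp
    qed
    with LM show "L = M \<and> p = q" by auto
  qed
  show "?h ` ?D = ?R"
  proof
    show "?h ` ?D \<subseteq> ?R"
    proof clarify
      fix L p assume L: "L \<in> set (k_subsets n k)" and p: "p permutes {0..<k}"
      have pi: "p i < k" if "i < k" for i using permutes_in_image[OF p, of i] that by simp
      have "L ! p i < n" if "i < k" for i
        using L pi[OF that] by (auto simp: set_k_subsets subset_iff)
      moreover have "inj_on (\<lambda>i. if i < k then L ! p i else i) {0..<k}"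
        using nth[OF L] pi permutes_inj[OF p] by (auto simp: inj_on_def)
      ultimately show "(\<forall>i\<in>{0..<k}. (if i < k then L ! p i else i) \<in> {0..<n}) \<and>
          (\<forall>i. i \<notin> {0..<k} \<longrightarrow> (if i < k then L ! p i else i) = i) \<and>
          inj_on (\<lambda>i. if i < k then L ! p i else i) {0..<k}" by auto
    qed
    show "?R \<subseteq> ?h ` ?D"
    proof
      fix f assume f: "f \<in> ?R"
      define L where "L = sorted_list_of_set (f ` {0..<k})"
      have L: "L \<in> set (k_subsets n k)" and sL: "set L = f ` {0..<k}"
        using f by (auto simp: set_k_subsets L_def card_image)
      \<comment> \<open>The permutation sends i to the position of f i in L.\<close>
      define p where "p = (\<lambda>i. if i < k then inv_into {0..<k} ((!) L) (f i) else i)"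
      have im: "(!) L ` {0..<k} = f ` {0..<k}"
        using L unfolding sL[symmetric] set_k_subsets by (auto simp: set_conv_nth)
      have pk: "p i < k" and Lp: "L ! p i = f i" if "i < k" for i
      proof -
        have "f i \<in> (!) L ` {0..<k}" using im that by simp
        then show "p i < k" "L ! p i = f i"
          using inv_into_into[of "f i" "(!) L" "{0..<k}"] f_inv_into_f[of "f i" "(!) L" "{0..<k}"] that
          by (auto simp: p_def)
      qed
      have "inj_on p {0..<k}"
      proof (rule inj_onI)
        fix a b assume ab: "a \<in> {0..<k}" "b \<in> {0..<k}" "p a = p b"
        then have "f a = f b" using Lp[of a] Lp[of b] by simp
        then show "a = b" using f ab by (auto simp: inj_on_def)
      qed
      moreover have "p ` {0..<k} \<subseteq> {0..<k}" using pk by auto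
      ultimately have "bij_betw p {0..<k} {0..<k}"
        by (auto simp: bij_betw_def dest: endo_inj_surj[rotated])
      then have "p permutes {0..<k}"
        by (rule bij_imp_permutes) (auto simp: p_def)
      moreover have "f = ?h (L, p)" using f Lp by (auto simp: fun_eq_iff)
      ultimately show "f \<in> ?h ` ?D" using L by blast
    qed
  qed
qed

text \<open>In the expansion by multilinearity, a non-injective f repeats a row of G and contributes
  0. The injective f are grouped by their image L, and within one group the sum over permutations
  reassembles into a minor of F.\<close>

theorem Cauchy_Binet:
  fixes F G :: "'a::comm_ring_1 mat"
  assumes F: "F \<in> carrier_mat k n" and G: "G \<in> carrier_mat n k"
  shows "det (F * G) = (\<Sum>L\<in>set (k_subsets n k).
    det (mat k k (\<lambda>(a, b). F $$ (a, L ! b))) * det (mat k k (\<lambda>(a, b). G $$ (L ! a, b))))"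
proof -
  let ?A = "{f. (\<forall>i\<in>{0..<k}. f i \<in> {0..<n}) \<and> (\<forall>i. i \<notin> {0..<k} \<longrightarrow> f i = i)}"
  let ?R = "{f. (\<forall>i\<in>{0..<k}. f i \<in> {0..<n}) \<and> (\<forall>i. i \<notin> {0..<k} \<longrightarrow> f i = i) \<and> inj_on f {0..<k}}"
  let ?P = "{p. p permutes {0..<k}}"
  let ?t = "\<lambda>f. (\<Prod>i = 0..<k. F $$ (i, f i)) * det (mat k k (\<lambda>(i, j). G $$ (f i, j)))"
  have fin: "finite ?A"
    using finite_bounded_functions[of "{0..<n}" "{0..<k}"] by simp
  have zero: "?t f = 0" if "f \<in> ?A - ?R" for f
  proof -
    from that obtain a b where "a < k" "b < k" "a \<noteq> b" "f a = f b" by (auto simp: inj_on_def)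
    then have "det (mat k k (\<lambda>(i, j). G $$ (f i, j))) = 0"
      by (intro det_identical_rows[of _ k a b]) auto
    then show ?thesis by simp
  qed
  have "det (F * G) = sum ?t ?A" by (rule det_mult_eq_sum_functions[OF F G])
  also have "\<dots> = sum ?t ?R"
    by (rule sum.mono_neutral_right[OF fin]) (use zero in auto)
  also have "\<dots> = (\<Sum>(L, p) \<in> set (k_subsets n k) \<times> ?P. ?t (\<lambda>i. if i < k then L ! p i else i))"
    by (subst sum.reindex_bij_betw[OF bij_betw_sorted_list_permutation, symmetric])
       (simp add: case_prod_unfold)
  also have "\<dots> = (\<Sum>L\<in>set (k_subsets n k). \<Sum>p\<in>?P. ?t (\<lambda>i. if i < k then L ! p i else i))"
    by (simp add: sum.cartesian_product)
  also have "\<dots> = (\<Sum>L\<in>set (k_subsets n k).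
    det (mat k k (\<lambda>(a, b). F $$ (a, L ! b))) * det (mat k k (\<lambda>(a, b). G $$ (L ! a, b))))"
  proof (rule sum.cong[OF refl])
    fix L assume L: "L \<in> set (k_subsets n k)"
    let ?G = "mat k k (\<lambda>(a, b). G $$ (L ! a, b))"
    have "?t (\<lambda>i. if i < k then L ! p i else i)
        = signof p * (\<Prod>i = 0..<k. F $$ (i, L ! p i)) * det ?G" if p: "p permutes {0..<k}" for p
    proof -
      \<comment> \<open>Composing the choice of rows with p permutes the rows of the minor
        \<open>?G\<close>, at the cost of \<open>signof p\<close>.\<close>
      have "mat k k (\<lambda>(i, j). G $$ (if i < k then L ! p i else i, j))
          = mat k k (\<lambda>(i, j). ?G $$ (p i, j))"
        using permutes_in_image[OF p] by (intro eq_matI) auto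
      then have "det (mat k k (\<lambda>(i, j). G $$ (if i < k then L ! p i else i, j)))
          = signof p * det ?G" using det_permute_rows[OF _ p, of ?G] by simp
      then show ?thesis by (simp add: algebra_simps)
    qed
    then have "(\<Sum>p\<in>?P. ?t (\<lambda>i. if i < k then L ! p i else i))
        = (\<Sum>p\<in>?P. signof p * (\<Prod>i = 0..<k. F $$ (i, L ! p i)) * det ?G)"
      by (intro sum.cong) auto
    also have "\<dots> = (\<Sum>p\<in>?P. signof p * (\<Prod>i = 0..<k. F $$ (i, L ! p i))) * det ?G"
      by (simp add: sum_distrib_right)
    \<comment> \<open>This is the Leibniz expansion of the minor of F with columns L.\<close>
    also have "(\<Sum>p\<in>?P. signof p * (\<Prod>i = 0..<k. F $$ (i, L ! p i)))
        = det (mat k k (\<lambda>(a, b). F $$ (a, L ! b)))"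
      using permutes_in_image by (auto simp: det_def intro!: sum.cong prod.cong)
    finally show "(\<Sum>p\<in>?P. ?t (\<lambda>i. if i < k then L ! p i else i))
        = det (mat k k (\<lambda>(a, b). F $$ (a, L ! b))) * det ?G" .
  qed
  finally show ?thesis .
qed

section \<open>The action of the compound matrix on vectors of minors\<close>

text \<open>For an n x k matrix G these are the coordinates of the wedge product of its columns in
  the standard basis of the k-th exterior power.\<close>

definition minors_vec :: "nat \<Rightarrow> nat \<Rightarrow> 'a::comm_ring_1 mat \<Rightarrow> 'a vec" where
  "minors_vec n k G = vec (length (k_subsets n k))
     (\<lambda>i. det (mat k k (\<lambda>(a, b). G $$ (k_subsets n k ! i ! a, b))))"

lemma ext_power_carrier:
  "A \<in> carrier_mat n n \<Longrightarrow>
    ext_power k A \<in> carrier_mat (length (k_subsets n k)) (length (k_subsets n k))"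
  by (auto simp: ext_power_def Let_def)

lemma sum_k_subsets:
  "(\<Sum>i = 0..<length (k_subsets n k). f (k_subsets n k ! i)) = sum f (set (k_subsets n k))"
proof -
  have "bij_betw ((!) (k_subsets n k)) {0..<length (k_subsets n k)} (set (k_subsets n k))"
    using bij_betw_nth[OF distinct_k_subsets, of "{0..<length (k_subsets n k)}" n k]
    by (simp add: lessThan_atLeast0)
  then show ?thesis by (rule sum.reindex_bij_betw)
qed

text \<open>In coordinates, the rule that the induced operator acts on each wedge factor separately.
  The entry at S is Cauchy-Binet for the rows S of A (the matrix \<open>?F\<close>) times G.\<close>

lemma ext_power_mult_minors_vec:
  fixes A :: "'a::comm_ring_1 mat"
  assumes A: "A \<in> carrier_mat n n" and G: "G \<in> carrier_mat n k"
  shows "ext_power k A *\<^sub>v minors_vec n k G = minors_vec n k (A * G)"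
proof (rule eq_vecI)
  let ?B = "k_subsets n k"
  show "dim_vec (ext_power k A *\<^sub>v minors_vec n k G) = dim_vec (minors_vec n k (A * G))"
    using ext_power_carrier[OF A, of k] by (simp add: minors_vec_def)
  fix i assume "i < dim_vec (minors_vec n k (A * G))"
  then have i: "i < length ?B" by (simp add: minors_vec_def)
  let ?S = "?B ! i"
  have S: "?S \<in> set ?B" using i by simp
  then have Sn: "?S ! a < n" if "a < k" for a using that by (auto simp: set_k_subsets subset_iff)
  let ?F = "mat k n (\<lambda>(a, c). A $$ (?S ! a, c))"
  have "(ext_power k A *\<^sub>v minors_vec n k G) $ i
      = (\<Sum>j = 0..<length ?B. det (submatrix A (set ?S) (set (?B ! j))) *
          det (mat k k (\<lambda>(a, b). G $$ (?B ! j ! a, b))))"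
    using A i by (simp add: ext_power_def Let_def minors_vec_def scalar_prod_def)
  also have "\<dots> = (\<Sum>j = 0..<length ?B. det (mat k k (\<lambda>(a, b). A $$ (?S ! a, ?B ! j ! b))) *
          det (mat k k (\<lambda>(a, b). G $$ (?B ! j ! a, b))))"
    by (intro sum.cong refl) (simp add: submatrix_sorted_lists[OF A S])
  also have "\<dots> = (\<Sum>L\<in>set ?B. det (mat k k (\<lambda>(a, b). A $$ (?S ! a, L ! b))) *
          det (mat k k (\<lambda>(a, b). G $$ (L ! a, b))))"
    by (rule sum_k_subsets)
  also have "\<dots> = (\<Sum>L\<in>set ?B. det (mat k k (\<lambda>(a, b). ?F $$ (a, L ! b))) *
          det (mat k k (\<lambda>(a, b). G $$ (L ! a, b))))"
    by (intro sum.cong refl arg_cong2[where f = "(*)"] arg_cong[where f = det] eq_matI)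
       (auto simp: set_k_subsets subset_iff)
  also have "\<dots> = det (?F * G)"
    by (rule Cauchy_Binet[symmetric, OF _ G]) simp
  also have "?F * G = mat k k (\<lambda>(a, b). (A * G) $$ (?S ! a, b))"
  proof (rule eq_matI)
    fix a b assume "a < dim_row (mat k k (\<lambda>(a, b). (A * G) $$ (?S ! a, b)))"
      "b < dim_col (mat k k (\<lambda>(a, b). (A * G) $$ (?S ! a, b)))"
    then have ab: "a < k" "b < k" by auto
    then show "(?F * G) $$ (a, b) = mat k k (\<lambda>(a, b). (A * G) $$ (?S ! a, b)) $$ (a, b)"
      using A G Sn[of a] by (auto simp: scalar_prod_def)
  qed (use G in auto)
  finally show "(ext_power k A *\<^sub>v minors_vec n k G) $ i = minors_vec n k (A * G) $ i"
    using i by (simp add: minors_vec_def)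
qed

lemma ext_power_pow_mult_minors_vec:
  fixes A :: "'a::comm_ring_1 mat"
  assumes A: "A \<in> carrier_mat n n"
  shows "G \<in> carrier_mat n k \<Longrightarrow>
    ext_power k A ^\<^sub>m i *\<^sub>v minors_vec n k G = minors_vec n k (A ^\<^sub>m i * G)"
proof (induction i arbitrary: G)
  case 0
  have "minors_vec n k G \<in> carrier_vec (length (k_subsets n k))" by (simp add: minors_vec_def)
  with 0 show ?case using A ext_power_carrier[OF A, of k] by simp
next
  case (Suc i)
  let ?X = "ext_power k A"
  have w: "minors_vec n k G \<in> carrier_vec (length (k_subsets n k))" by (simp add: minors_vec_def)
  \<comment> \<open>Powers grow on the right, so the extra factor acts first and the induction
    hypothesis is needed for A * G; hence G is arbitrary in the induction.\<close>
  have "?X ^\<^sub>m Suc i *\<^sub>v minors_vec n k G = ?X ^\<^sub>m i *\<^sub>v (?X *\<^sub>v minors_vec n k G)"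
    using assoc_mult_mat_vec[OF pow_carrier_mat[OF ext_power_carrier[OF A]] ext_power_carrier[OF A] w]
    by simp
  also have "\<dots> = minors_vec n k (A ^\<^sub>m i * (A * G))"
    using A Suc.prems by (simp add: ext_power_mult_minors_vec Suc.IH)
  also have "A ^\<^sub>m i * (A * G) = A ^\<^sub>m Suc i * G"
    using assoc_mult_mat[OF pow_carrier_mat[OF A] A Suc.prems] by simp
  finally show ?case .
qed

text \<open>Cauchy-Binet read as a pairing: the rows of F are functionals and the columns of G
  vectors, and their wedge products pair to the determinant of the matrix of individual
  pairings.\<close>

lemma minors_vec_scalar_prod:
  fixes F G :: "'a::comm_ring_1 mat"
  assumes F: "F \<in> carrier_mat k n" and G: "G \<in> carrier_mat n k"
  shows "minors_vec n k (transpose_mat F) \<bullet> minors_vec n k G = det (F * G)"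
proof -
  let ?B = "k_subsets n k"
  have tr: "det (mat k k (\<lambda>(a, b). transpose_mat F $$ (L ! a, b)))
      = det (mat k k (\<lambda>(a, b). F $$ (a, L ! b)))" if "L \<in> set ?B" for L
  proof -
    have "mat k k (\<lambda>(a, b). transpose_mat F $$ (L ! a, b))
        = transpose_mat (mat k k (\<lambda>(a, b). F $$ (a, L ! b)))"
      using F that by (intro eq_matI) (auto simp: set_k_subsets subset_iff)
    then show ?thesis by (simp add: det_transpose[of _ k])
  qed
  have "minors_vec n k (transpose_mat F) \<bullet> minors_vec n k G
      = (\<Sum>j = 0..<length ?B. det (mat k k (\<lambda>(a, b). transpose_mat F $$ (?B ! j ! a, b))) *
          det (mat k k (\<lambda>(a, b). G $$ (?B ! j ! a, b))))"
    by (simp add: minors_vec_def scalar_prod_def)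
  also have "\<dots> = (\<Sum>L\<in>set ?B. det (mat k k (\<lambda>(a, b). transpose_mat F $$ (L ! a, b))) *
          det (mat k k (\<lambda>(a, b). G $$ (L ! a, b))))"
    by (rule sum_k_subsets)
  also have "\<dots> = (\<Sum>L\<in>set ?B. det (mat k k (\<lambda>(a, b). F $$ (a, L ! b))) *
          det (mat k k (\<lambda>(a, b). G $$ (L ! a, b))))"
    by (intro sum.cong refl) (simp add: tr)
  also have "\<dots> = det (F * G)" by (rule Cauchy_Binet[symmetric, OF F G])
  finally show ?thesis .
qed

text \<open>Multiplying by X - 1 takes forward differences of the sequence i \<mapsto> u \<bullet> X^i w.\<close>

lemma minus_one_pow_nonzero:
  fixes X :: "'a::comm_ring_1 mat"
  assumes X: "X \<in> carrier_mat N N" and u: "u \<in> carrier_vec N" and w: "w \<in> carrier_vec N"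
    and s0: "u \<bullet> w \<noteq> 0"
    and s: "\<And>j. 1 \<le> j \<Longrightarrow> j \<le> m \<Longrightarrow> u \<bullet> (X ^\<^sub>m j *\<^sub>v w) = 0"
  shows "(X - 1\<^sub>m N) ^\<^sub>m m \<noteq> 0\<^sub>m N N"
proof
  let ?Y = "X - 1\<^sub>m N"
  \<comment> \<open>\<open>d q i\<close> is the q-th forward difference at i of the sequence u . X^i
    w.\<close>
  define d where "d q i = u \<bullet> (?Y ^\<^sub>m q *\<^sub>v (X ^\<^sub>m i *\<^sub>v w))" for q i
  have Y: "?Y \<in> carrier_mat N N" by (intro minus_carrier_mat one_carrier_mat)
  have Xi: "X ^\<^sub>m i *\<^sub>v w \<in> carrier_vec N" for i
    using mult_mat_vec_carrier[OF pow_carrier_mat[OF X] w] .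
  have comm: "X * X ^\<^sub>m i = X ^\<^sub>m i * X" for i
  proof (induction i)
    case (Suc i)
    have "X * (X ^\<^sub>m i * X) = X * X ^\<^sub>m i * X"
      using assoc_mult_mat[OF X pow_carrier_mat[OF X] X, of i] by simp
    with Suc show ?case by simp
  qed (use X in simp)
  have d_Suc: "d (Suc q) i = d q (Suc i) - d q i" for q i
  proof -
    have "?Y ^\<^sub>m Suc q *\<^sub>v (X ^\<^sub>m i *\<^sub>v w) = ?Y ^\<^sub>m q *\<^sub>v (?Y *\<^sub>v (X ^\<^sub>m i *\<^sub>v w))"
      using assoc_mult_mat_vec[OF pow_carrier_mat[OF Y] Y Xi] by simp
    also have "?Y *\<^sub>v (X ^\<^sub>m i *\<^sub>v w) = X *\<^sub>v (X ^\<^sub>m i *\<^sub>v w) - X ^\<^sub>m i *\<^sub>v w"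
      using minus_mult_distrib_mat_vec[OF X one_carrier_mat Xi] one_mult_mat_vec[OF Xi] by simp
    also have "X *\<^sub>v (X ^\<^sub>m i *\<^sub>v w) = X ^\<^sub>m Suc i *\<^sub>v w"
      using assoc_mult_mat_vec[OF X pow_carrier_mat[OF X] w] comm by simp
    also have "?Y ^\<^sub>m q *\<^sub>v (X ^\<^sub>m Suc i *\<^sub>v w - X ^\<^sub>m i *\<^sub>v w)
        = ?Y ^\<^sub>m q *\<^sub>v (X ^\<^sub>m Suc i *\<^sub>v w) - ?Y ^\<^sub>m q *\<^sub>v (X ^\<^sub>m i *\<^sub>v w)"
      by (rule mult_minus_distrib_mat_vec[OF pow_carrier_mat[OF Y] Xi Xi])
    finally have e: "?Y ^\<^sub>m Suc q *\<^sub>v (X ^\<^sub>m i *\<^sub>v w)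
        = ?Y ^\<^sub>m q *\<^sub>v (X ^\<^sub>m Suc i *\<^sub>v w) - ?Y ^\<^sub>m q *\<^sub>v (X ^\<^sub>m i *\<^sub>v w)" .
    have c: "?Y ^\<^sub>m q *\<^sub>v (X ^\<^sub>m i *\<^sub>v w) \<in> carrier_vec N" for i
      by (rule mult_mat_vec_carrier[OF pow_carrier_mat[OF Y] Xi])
    show ?thesis unfolding d_def e by (rule scalar_prod_minus_distrib[OF u c c])
  qed
  have d0: "d 0 i = u \<bullet> (X ^\<^sub>m i *\<^sub>v w)" for i
    unfolding d_def using Y Xi[of i] X by simp
  \<comment> \<open>The q-th difference at i involves only the terms i, ..., i + q. For i >= 1 these
    all vanish; at 0 just the initial term survives, with coefficient (-1)^q. Both claims are proved
    together, since the difference at 0 also needs the one at 1.\<close>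
  have "(1 \<le> i \<longrightarrow> i + q \<le> m \<longrightarrow> d q i = 0) \<and> (q \<le> m \<longrightarrow> d q 0 = (-1) ^ q * (u \<bullet> w))" for q i
  proof (induction q arbitrary: i)
    case 0
    show ?case using s[of i] d0 X w by simp
  next
    case (Suc q)
    show ?case using Suc[of i] Suc[of "Suc i"] Suc[of 1] by (auto simp: d_Suc)
  qed
  then have "d m 0 = (-1) ^ m * (u \<bullet> w)" by blast
  then have "d m 0 \<noteq> 0" using s0 by (cases "even m") auto
  moreover assume "?Y ^\<^sub>m m = 0\<^sub>m N N"
  moreover have "0\<^sub>m N N *\<^sub>v w = 0\<^sub>v N" using w by (intro eq_vecI) auto
  ultimately show False unfolding d_def using u X w by simp
qed

section \<open>Extending one-sided inverses\<close>

lemma right_inverse_imp_le: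
  fixes E G :: "'a::field mat"
  assumes E: "E \<in> carrier_mat r n" and G: "G \<in> carrier_mat n r" and EG: "E * G = 1\<^sub>m r"
  shows "r \<le> n"
proof (rule ccontr)
  assume "\<not> r \<le> n"
  then have nr: "n < r" by simp
  \<comment> \<open>Padded with zeros to square matrices, the two factors would commute.\<close>
  let ?E = "mat r r (\<lambda>(i, j). if j < n then E $$ (i, j) else 0)"
  let ?G = "mat r r (\<lambda>(i, j). if i < n then G $$ (i, j) else 0)"
  have "?E * ?G = E * G"
  proof (rule eq_matI)
    fix i j assume "i < dim_row (E * G)" "j < dim_col (E * G)"
    then have ij: "i < r" "j < r" using E G by auto
    have "(?E * ?G) $$ (i, j) = (\<Sum>c = 0..<r. if c < n then E $$ (i, c) * G $$ (c, j) else 0)"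
      using ij by (auto simp: scalar_prod_def intro!: sum.cong)
    also have "\<dots> = (\<Sum>c = 0..<n. E $$ (i, c) * G $$ (c, j))"
      using nr by (intro sum.mono_neutral_cong_right) auto
    finally show "(?E * ?G) $$ (i, j) = (E * G) $$ (i, j)"
      using ij E G by (simp add: scalar_prod_def)
  qed (use E G in auto)
  then have "?G * ?E = 1\<^sub>m r"
    using mat_mult_left_right_inverse[of ?E r ?G] EG by simp
  \<comment> \<open>Row n of \<open>?G\<close> lies in the zero padding, whereas the identity has 1
    at this diagonal position.\<close>
  moreover have "(?G * ?E) $$ (n, n) = 0" using nr by (simp add: scalar_prod_def)
  ultimately show False using nr by simp
qed

text \<open>P = 1 - G E is the projection onto the kernel of E along the column space of G. Its
  columns are killed by E and its rows kill the columns of G. For a nonzero entry (p, t), row p and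
  column t pair to that entry because P is idempotent, so after rescaling the row they form a new
  biorthogonal pair.\<close>

lemma extend_right_inverse_Suc:
  fixes E G :: "'a::field mat"
  assumes E: "E \<in> carrier_mat s n" and G: "G \<in> carrier_mat n s" and EG: "E * G = 1\<^sub>m s"
    and "s < n"
  obtains E' G' where "E' \<in> carrier_mat (Suc s) n" "G' \<in> carrier_mat n (Suc s)"
    "E' * G' = 1\<^sub>m (Suc s)" "\<And>i. i < s \<Longrightarrow> row E' i = row E i"
proof -
  define P where "P = 1\<^sub>m n - G * E"
  have GE: "G * E \<in> carrier_mat n n" using G E by simp
  have P: "P \<in> carrier_mat n n" unfolding P_def by (intro minus_carrier_mat GE)
  have "E * P = E * 1\<^sub>m n - E * (G * E)"
    unfolding P_def by (rule mult_minus_distrib_mat[OF E one_carrier_mat GE])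
  also have "E * (G * E) = E" using assoc_mult_mat[OF E G E] EG E by simp
  finally have EP: "E * P = 0\<^sub>m s n" using E by simp
  have "P * G = 1\<^sub>m n * G - G * E * G"
    unfolding P_def by (rule minus_mult_distrib_mat[OF one_carrier_mat GE G])
  also have "G * E * G = G" using assoc_mult_mat[OF G E G] EG G by simp
  finally have PG: "P * G = 0\<^sub>m n s" using G by simp
  have "P * P = P * 1\<^sub>m n - P * (G * E)"
    by (subst (2) P_def) (rule mult_minus_distrib_mat[OF P one_carrier_mat GE])
  also have "P * (G * E) = 0\<^sub>m n n" using assoc_mult_mat[OF P G E] PG E by simp
  also have "P * 1\<^sub>m n - 0\<^sub>m n n = P" using P by (intro eq_matI) auto
  finally have PP: "P * P = P" .
  \<comment> \<open>Otherwise G would have the right inverse E, forcing n <= s.\<close>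
  have "P \<noteq> 0\<^sub>m n n"
  proof
    assume P0: "P = 0\<^sub>m n n"
    have "G * E = 1\<^sub>m n"
    proof (rule eq_matI)
      fix i j assume "i < dim_row (1\<^sub>m n)" "j < dim_col (1\<^sub>m n)"
      then have ij: "i < n" "j < n" by auto
      have "P $$ (i, j) = 0" using P0 ij by simp
      then show "(G * E) $$ (i, j) = 1\<^sub>m n $$ (i, j)"
        using ij GE unfolding P_def by (subst (asm) index_minus_mat) auto
    qed (use GE in auto)
    from right_inverse_imp_le[OF G E this] \<open>s < n\<close> show False by simp
  qed
  then obtain p t where pt: "p < n" "t < n" "P $$ (p, t) \<noteq> 0"
    using P by (metis carrier_matD eq_matI index_zero_mat)
  define E' where "E' = mat (Suc s) n
    (\<lambda>(i, c). if i < s then E $$ (i, c) else P $$ (p, c) / P $$ (p, t))"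
  define G' where "G' = mat n (Suc s) (\<lambda>(c, j). if j < s then G $$ (c, j) else P $$ (c, t))"
  have sums: "(\<Sum>c = 0..<n. E $$ (i, c) * G $$ (c, j)) = (if i = j then 1 else 0)"
      "(\<Sum>c = 0..<n. E $$ (i, c) * P $$ (c, t)) = 0"
      "(\<Sum>c = 0..<n. P $$ (p, c) * G $$ (c, j)) = 0" if "i < s" "j < s" for i j
    using arg_cong[OF EG, of "\<lambda>M. M $$ (i, j)"] arg_cong[OF EP, of "\<lambda>M. M $$ (i, t)"]
      arg_cong[OF PG, of "\<lambda>M. M $$ (p, j)"]
      that pt E G P by (simp_all add: scalar_prod_def)
  have pp: "(\<Sum>c = 0..<n. P $$ (p, c) * P $$ (c, t)) = P $$ (p, t)"
    using arg_cong[OF PP, of "\<lambda>M. M $$ (p, t)"] pt P by (simp add: scalar_prod_def)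
  have "E' * G' = 1\<^sub>m (Suc s)"
  proof (rule eq_matI)
    fix i j assume "i < dim_row (1\<^sub>m (Suc s) :: 'a mat)" "j < dim_col (1\<^sub>m (Suc s) :: 'a mat)"
    then have ij: "i < Suc s" "j < Suc s" by auto
    have *: "(E' * G') $$ (i, j) = (\<Sum>c = 0..<n. E' $$ (i, c) * G' $$ (c, j))"
      using ij by (simp add: E'_def G'_def scalar_prod_def)
    \<comment> \<open>Each fact in \<open>sums\<close> requires two indices below s; in the border
      blocks only one is available, so it is used twice.\<close>
    show "(E' * G') $$ (i, j) = 1\<^sub>m (Suc s) $$ (i, j)"
      unfolding * using ij sums[of i j] sums(2)[of i i] sums(3)[of j j] pp pt
      by (cases "i < s"; cases "j < s")
         (auto simp: E'_def G'_def less_Suc_eq simp flip: sum_divide_distrib)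
  qed (auto simp: E'_def G'_def)
  moreover have "row E' i = row E i" if "i < s" for i
    using that E by (intro eq_vecI) (auto simp: E'_def)
  ultimately show ?thesis by (intro that[of E' G']) (auto simp: E'_def G'_def)
qed

text \<open>Only the old rows are tracked: the later argument must recognise the first functionals,
  while biorthogonality is all it uses of the dual vectors.\<close>

lemma extend_right_inverse:
  fixes E G :: "'a::field mat"
  assumes E: "E \<in> carrier_mat r n" and G: "G \<in> carrier_mat n r" and EG: "E * G = 1\<^sub>m r"
    and "r \<le> s" "s \<le> n"
  shows "\<exists>E' G'. E' \<in> carrier_mat s n \<and> G' \<in> carrier_mat n s \<and> E' * G' = 1\<^sub>m s \<and>
    (\<forall>i<r. row E' i = row E i)"
  using \<open>r \<le> s\<close> \<open>s \<le> n\<close>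
proof (induction s rule: dec_induct)
  case base
  show ?case using E G EG by blast
next
  case (step s)
  then obtain E1 G1 where 1: "E1 \<in> carrier_mat s n" "G1 \<in> carrier_mat n s" "E1 * G1 = 1\<^sub>m s"
    and r1: "\<forall>i<r. row E1 i = row E i" by auto
  from step.prems have "s < n" by simp
  from extend_right_inverse_Suc[OF 1 this] obtain E' G' where
    "E' \<in> carrier_mat (Suc s) n" "G' \<in> carrier_mat n (Suc s)" "E' * G' = 1\<^sub>m (Suc s)"
    "\<And>i. i < s \<Longrightarrow> row E' i = row E1 i" by blast
  with r1 \<open>r \<le> s\<close> show ?case by (intro exI[of _ E'] exI[of _ G']) auto
qed

section \<open>Functionals along a unipotent operator\<close>

lemma pow_mat_add:
  fixes A :: "'a::semiring_1 mat"
  assumes A: "A \<in> carrier_mat n n"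
  shows "A ^\<^sub>m (i + j) = A ^\<^sub>m i * A ^\<^sub>m j"
proof (induction j)
  case (Suc j)
  then show ?case
    using assoc_mult_mat[OF pow_carrier_mat[OF A] pow_carrier_mat[OF A] A, of i j] by simp
qed (use A in simp)

lemma pow_mat_add_mult_vec:
  fixes A :: "'a::semiring_1 mat"
  assumes A: "A \<in> carrier_mat n n" and x: "x \<in> carrier_vec n"
  shows "A ^\<^sub>m (i + j) *\<^sub>v x = A ^\<^sub>m i *\<^sub>v (A ^\<^sub>m j *\<^sub>v x)"
  using assoc_mult_mat_vec[OF pow_carrier_mat[OF A] pow_carrier_mat[OF A] x]
  by (simp add: pow_mat_add[OF A])

text \<open>Let m be the least exponent with M^m = 0 and let (a, c) be a nonzero entry of M^(m-1).
  The functional f takes the a-th coordinate after applying M^(m-1-d): then f M^d reads row a of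
  M^(m-1), and f M^j vanishes for j > d. The vector v is the c-th unit vector, scaled to give
  1.\<close>

lemma nilpotent_functional:
  fixes M :: "'a::field mat"
  assumes M: "M \<in> carrier_mat n n" and nil: "M ^\<^sub>m r = 0\<^sub>m n n" and nz: "M ^\<^sub>m d \<noteq> 0\<^sub>m n n"
  obtains f v where "f \<in> carrier_vec n" "v \<in> carrier_vec n" "f \<bullet> (M ^\<^sub>m d *\<^sub>v v) = 1"
    "\<And>j x. d < j \<Longrightarrow> x \<in> carrier_vec n \<Longrightarrow> f \<bullet> (M ^\<^sub>m j *\<^sub>v x) = 0"
proof -
  note Mp = pow_carrier_mat[OF M]
  define m where "m = (LEAST m. M ^\<^sub>m m = 0\<^sub>m n n)"
  have m0: "M ^\<^sub>m m = 0\<^sub>m n n" unfolding m_def using nil by (rule LeastI)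
  have mj: "M ^\<^sub>m j = 0\<^sub>m n n" if "m \<le> j" for j
    using pow_mat_add[OF M, of m "j - m"] m0 that left_mult_zero_mat[OF Mp[of "j - m"]] by simp
  have dm: "d < m" using mj[of d] nz by force
  have "M ^\<^sub>m (m - 1) \<noteq> 0\<^sub>m n n"
    using not_less_Least[of "m - 1" "\<lambda>m. M ^\<^sub>m m = 0\<^sub>m n n"] dm unfolding m_def[symmetric] by simp
  then obtain a c where ac: "a < n" "c < n" "(M ^\<^sub>m (m - 1)) $$ (a, c) \<noteq> 0"
    using Mp[of "m - 1"] by (metis carrier_matD eq_matI index_zero_mat)
  define t where "t = m - 1 - d"
  define f where "f = transpose_mat (M ^\<^sub>m t) *\<^sub>v unit_vec n a"
  have f: "f \<in> carrier_vec n"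
    unfolding f_def by (rule mult_mat_vec_carrier[OF _ unit_vec_carrier]) (use Mp in simp)
  have fx: "f \<bullet> (M ^\<^sub>m j *\<^sub>v x) = (M ^\<^sub>m (t + j) *\<^sub>v x) $ a" if x: "x \<in> carrier_vec n" for j x
  proof -
    have y: "M ^\<^sub>m j *\<^sub>v x \<in> carrier_vec n" by (rule mult_mat_vec_carrier[OF Mp x])
    have "f \<bullet> (M ^\<^sub>m j *\<^sub>v x) = unit_vec n a \<bullet> (M ^\<^sub>m t *\<^sub>v (M ^\<^sub>m j *\<^sub>v x))"
      unfolding f_def by (rule transpose_vec_mult_scalar[OF Mp y unit_vec_carrier])
    also have "\<dots> = unit_vec n a \<bullet> (M ^\<^sub>m (t + j) *\<^sub>v x)"
      by (simp add: pow_mat_add_mult_vec[OF M x])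
    also have "\<dots> = (M ^\<^sub>m (t + j) *\<^sub>v x) $ a"
      by (rule scalar_prod_left_unit[OF mult_mat_vec_carrier[OF Mp x] ac(1)])
    finally show ?thesis .
  qed
  let ?e = "(M ^\<^sub>m (m - 1)) $$ (a, c)"
  define v where "v = (1 / ?e) \<cdot>\<^sub>v unit_vec n c"
  have v: "v \<in> carrier_vec n" by (simp add: v_def)
  have "t + d = m - 1" using dm by (simp add: t_def)
  then have "f \<bullet> (M ^\<^sub>m d *\<^sub>v v) = (M ^\<^sub>m (m - 1) *\<^sub>v v) $ a" using fx[OF v, of d] by simp
  also have "\<dots> = row (M ^\<^sub>m (m - 1)) a \<bullet> v" using M ac by simp
  also have "\<dots> = (1 / ?e) * (row (M ^\<^sub>m (m - 1)) a \<bullet> unit_vec n c)"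
    unfolding v_def using Mp[of "m - 1"] ac M by (intro scalar_prod_smult_distrib[of _ n]) auto
  also have "row (M ^\<^sub>m (m - 1)) a \<bullet> unit_vec n c = ?e"
    using M ac by (subst scalar_prod_right_unit[of _ n]) auto
  finally have 1: "f \<bullet> (M ^\<^sub>m d *\<^sub>v v) = 1" using ac by simp
  have 0: "f \<bullet> (M ^\<^sub>m j *\<^sub>v x) = 0" if "d < j" and x: "x \<in> carrier_vec n" for j x
  proof -
    have "m \<le> t + j" using that dm by (simp add: t_def)
    then show ?thesis using fx[OF x, of j] mj[of "t + j"] x ac by simp
  qed
  show ?thesis by (rule that[OF f v 1 0])
qed

text \<open>The binomial theorem for A = 1 + N, evaluated under f so that only scalars are
  summed.\<close>

lemma binomial_pow_mat_functional:
  fixes A :: "'a::comm_ring_1 mat"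
  assumes A: "A \<in> carrier_mat n n" and f: "f \<in> carrier_vec n"
  shows "x \<in> carrier_vec n \<Longrightarrow> f \<bullet> (A ^\<^sub>m q *\<^sub>v x) =
    (\<Sum>j\<le>q. of_nat (q choose j) * (f \<bullet> ((A - 1\<^sub>m n) ^\<^sub>m j *\<^sub>v x)))"
proof (induction q arbitrary: x)
  case 0
  then show ?case using A by simp
next
  case (Suc q)
  let ?N = "A - 1\<^sub>m n"
  let ?h = "\<lambda>j. f \<bullet> (?N ^\<^sub>m j *\<^sub>v x)"
  note x = Suc.prems
  have N: "?N \<in> carrier_mat n n" by (intro minus_carrier_mat one_carrier_mat)
  have Nx: "?N *\<^sub>v x = A *\<^sub>v x - x"
    using minus_mult_distrib_mat_vec[OF A one_carrier_mat x] x by simp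
  have Nxc: "?N *\<^sub>v x \<in> carrier_vec n" by (rule mult_mat_vec_carrier[OF N x])
  have Ax: "A *\<^sub>v x = x + ?N *\<^sub>v x"
    unfolding Nx using A x by (intro eq_vecI) auto
  have h: "f \<bullet> (?N ^\<^sub>m j *\<^sub>v (A *\<^sub>v x)) = ?h j + ?h (Suc j)" for j
  proof -
    note Nj = pow_carrier_mat[OF N, of j]
    have "?N ^\<^sub>m j *\<^sub>v (A *\<^sub>v x) = ?N ^\<^sub>m j *\<^sub>v x + ?N ^\<^sub>m j *\<^sub>v (?N *\<^sub>v x)"
      unfolding Ax by (rule mult_add_distrib_mat_vec[OF Nj x Nxc])
    also have "?N ^\<^sub>m j *\<^sub>v (?N *\<^sub>v x) = ?N ^\<^sub>m Suc j *\<^sub>v x"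
      using assoc_mult_mat_vec[OF Nj N x] by simp
    finally show ?thesis
      by (simp only: scalar_prod_add_distrib[OF f mult_mat_vec_carrier[OF Nj x]
          mult_mat_vec_carrier[OF pow_carrier_mat[OF N] x]])
  qed
  have "f \<bullet> (A ^\<^sub>m Suc q *\<^sub>v x) = f \<bullet> (A ^\<^sub>m q *\<^sub>v (A *\<^sub>v x))"
    using assoc_mult_mat_vec[OF pow_carrier_mat[OF A] A x] by simp
  also have "\<dots> = (\<Sum>j\<le>q. of_nat (q choose j) * (?h j + ?h (Suc j)))"
    using Suc.IH[OF mult_mat_vec_carrier[OF A x]] by (simp only: h)
  also have "\<dots> = (\<Sum>j\<le>q. of_nat (q choose j) * ?h j) + (\<Sum>j\<le>q. of_nat (q choose j) * ?h (Suc j))"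
    by (simp add: ring_distribs sum.distrib)
  \<comment> \<open>The added top term has coefficient 0. Once j = 0 is split off, the two sums
    merge by Pascal's rule.\<close>
  also have "(\<Sum>j\<le>q. of_nat (q choose j) * ?h j) = (\<Sum>j\<le>Suc q. of_nat (q choose j) * ?h j)"
    by (simp add: binomial_eq_0)
  also have "\<dots> = ?h 0 + (\<Sum>j\<le>q. of_nat (q choose Suc j) * ?h (Suc j))"
    by (subst sum.atMost_Suc_shift) simp
  also have "\<dots> + (\<Sum>j\<le>q. of_nat (q choose j) * ?h (Suc j))
      = ?h 0 + (\<Sum>j\<le>q. of_nat (Suc q choose Suc j) * ?h (Suc j))"
    by (simp add: ring_distribs sum.distrib algebra_simps del: pow_mat.simps)
  also have "\<dots> = (\<Sum>j\<le>Suc q. of_nat (Suc q choose j) * ?h j)"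
    by (subst sum.atMost_Suc_shift) simp
  finally show ?case .
qed

text \<open>Linear independence of f, f A, ..., f A^d, in the usable form of a family of dual
  vectors, the columns of G.\<close>

lemma power_functionals_right_inverse:
  fixes A :: "'a::field mat"
  assumes A: "A \<in> carrier_mat n n" and f: "f \<in> carrier_vec n" and v: "v \<in> carrier_vec n"
    and one: "f \<bullet> ((A - 1\<^sub>m n) ^\<^sub>m d *\<^sub>v v) = 1"
    and zero: "\<And>j x. d < j \<Longrightarrow> x \<in> carrier_vec n \<Longrightarrow> f \<bullet> ((A - 1\<^sub>m n) ^\<^sub>m j *\<^sub>v x) = 0"
  obtains E G where "E \<in> carrier_mat (Suc d) n" "G \<in> carrier_mat n (Suc d)"
    "E * G = 1\<^sub>m (Suc d)"
    "\<And>i x. i \<le> d \<Longrightarrow> x \<in> carrier_vec n \<Longrightarrow> row E i \<bullet> x = f \<bullet> (A ^\<^sub>m i *\<^sub>v x)"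
proof -
  let ?N = "A - 1\<^sub>m n" and ?d = "Suc d"
  have N: "?N \<in> carrier_mat n n" by (intro minus_carrier_mat one_carrier_mat)
  define E where "E = mat\<^sub>r ?d n (\<lambda>i. transpose_mat (A ^\<^sub>m i) *\<^sub>v f)"
  define K where "K = mat n ?d (\<lambda>(c, b). (?N ^\<^sub>m (d - b) *\<^sub>v v) $ c)"
  define L where "L = mat ?d ?d (\<lambda>(i, j). of_nat (i choose j) :: 'a)"
  define U where "U = mat ?d ?d (\<lambda>(j, b). f \<bullet> (?N ^\<^sub>m (j + (d - b)) *\<^sub>v v))"
  have E: "E \<in> carrier_mat ?d n" and K: "K \<in> carrier_mat n ?d"
    and L: "L \<in> carrier_mat ?d ?d" and U: "U \<in> carrier_mat ?d ?d"
    by (auto simp: E_def K_def L_def U_def)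
  have rowE: "row E i \<bullet> x = f \<bullet> (A ^\<^sub>m i *\<^sub>v x)" if "i \<le> d" "x \<in> carrier_vec n" for i x
  proof -
    have "transpose_mat (A ^\<^sub>m i) *\<^sub>v f \<in> carrier_vec n"
      using pow_carrier_mat[OF A, of i] f by (intro mult_mat_vec_carrier[of _ n n]) auto
    then have "row E i = transpose_mat (A ^\<^sub>m i) *\<^sub>v f" unfolding E_def
        using that(1) A by (intro row_mat_of_row_fun) auto
    then show ?thesis
      using transpose_vec_mult_scalar[OF pow_carrier_mat[OF A] that(2) f] by simp
  qed
  \<comment> \<open>The vectors N^(d-b) v are dual to the functionals f N^j up to a unitriangular matrix U,
    and f A^i is a unitriangular (binomial) combination of the f N^j.\<close>
  have "E * K = L * U"
  proof (rule eq_matI)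
    fix i b assume "i < dim_row (L * U)" "b < dim_col (L * U)"
    then have ib: "i \<le> d" "b \<le> d" using L U by auto
    let ?w = "?N ^\<^sub>m (d - b) *\<^sub>v v"
    have w: "?w \<in> carrier_vec n" by (rule mult_mat_vec_carrier[OF pow_carrier_mat[OF N] v])
    have "(E * K) $$ (i, b) = row E i \<bullet> col K b" using ib E K by simp
    also have "col K b = ?w" using ib w by (intro eq_vecI) (auto simp: K_def)
    also have "row E i \<bullet> ?w = f \<bullet> (A ^\<^sub>m i *\<^sub>v ?w)" by (rule rowE[OF ib(1) w])
    also have "\<dots> = (\<Sum>j\<le>i. of_nat (i choose j) * (f \<bullet> (?N ^\<^sub>m j *\<^sub>v ?w)))"
      by (rule binomial_pow_mat_functional[OF A f w])
    also have "\<dots> = (\<Sum>j\<le>d. of_nat (i choose j) * (f \<bullet> (?N ^\<^sub>m j *\<^sub>v ?w)))"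
      using ib by (intro sum.mono_neutral_left) (auto simp: binomial_eq_0)
    also have "\<dots> = (\<Sum>j\<le>d. of_nat (i choose j) * (f \<bullet> (?N ^\<^sub>m (j + (d - b)) *\<^sub>v v)))"
      by (simp add: pow_mat_add_mult_vec[OF N v])
    also have "\<dots> = (L * U) $$ (i, b)"
      using ib unfolding L_def U_def
      by (auto simp: scalar_prod_def atLeast0AtMost atLeastLessThanSuc_atLeastAtMost intro!: sum.cong)
    finally show "(E * K) $$ (i, b) = (L * U) $$ (i, b)" .
  qed (use E K L U in auto)
  moreover have "det L = 1"
    by (subst det_lower_triangular[OF _ L])
       (auto simp: L_def prod_list_diag_prod binomial_eq_0)
  \<comment> \<open>Below the diagonal (j > b) the exponent j + (d - b) exceeds d and the entry is
    0; on the diagonal it equals d and the entry is 1.\<close>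
  moreover have "det U = 1"
    using zero v one
    by (subst det_upper_triangular[OF _ U])
       (auto simp: U_def upper_triangular_def prod_list_diag_prod)
  ultimately have "det (E * K) \<noteq> 0" using det_mult[OF L U] by simp
  \<comment> \<open>Correcting K by the inverse C of E * K yields the exact dual vectors K *
    C.\<close>
  from det_non_zero_imp_unit[OF mult_carrier_mat[OF E K] this, of undefined]
  obtain C where C: "C \<in> carrier_mat ?d ?d" "E * K * C = 1\<^sub>m ?d"
    by (auto simp: Units_def ring_mat_simps)
  show ?thesis
    by (rule that[of E "K * C"]) (use E K C rowE in auto)
qed

section \<open>The functional and the vector on the exterior power\<close>

lemma ext_power_unipotent_pow_nonzero:
  fixes A :: "'a::field mat"
  assumes CH: "CHAR('a) = l" and l: "l \<ge> 5"
    and A: "A \<in> carrier_mat n n" and k: "2 \<le> k" "k \<le> n - 2"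
    and f: "f \<in> carrier_vec n" and v: "v \<in> carrier_vec n"
    and one: "f \<bullet> ((A - 1\<^sub>m n) ^\<^sub>m (l - 2) *\<^sub>v v) = 1"
    and zero: "\<And>j x. l - 2 < j \<Longrightarrow> x \<in> carrier_vec n \<Longrightarrow> f \<bullet> ((A - 1\<^sub>m n) ^\<^sub>m j *\<^sub>v x) = 0"
  shows "(ext_power k A - 1\<^sub>m (length (k_subsets n k))) ^\<^sub>m (l - 1)
    \<noteq> 0\<^sub>m (length (k_subsets n k)) (length (k_subsets n k))"
proof -
  \<comment> \<open>The characteristic of a field is 0 or prime, and l >= 5 excludes 0.\<close>
  have prime: "prime l" using prime_CHAR_semidom[where 'a = 'a] CH l by simp
  have Sl: "Suc (l - 2) = l - 1" using l by simp
  obtain E0 G0 where E0: "E0 \<in> carrier_mat (l - 1) n" and G0: "G0 \<in> carrier_mat n (l - 1)"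
    and EG0: "E0 * G0 = 1\<^sub>m (l - 1)"
    and row0: "\<And>i x. i \<le> l - 2 \<Longrightarrow> x \<in> carrier_vec n \<Longrightarrow> row E0 i \<bullet> x = f \<bullet> (A ^\<^sub>m i *\<^sub>v x)"
    using power_functionals_right_inverse[OF A f v one zero] unfolding Sl by metis
  have ln: "l - 1 \<le> n" by (rule right_inverse_imp_le[OF E0 G0 EG0])
  \<comment> \<open>As few wedge factors as possible (but at least 2) come from the orbit of f: the n - (l - 1)
    extra dimensions may be too few to supply the other k - 2.\<close>
  define k1 where "k1 = (if k - 2 \<le> n - (l - 1) then 2 else k - (n - (l - 1)))"
  \<comment> \<open>The bound k1 <= l - 3 comes from l >= 5 in the first case and from k <= n - 2 in
    the second.\<close>
  have k1: "2 \<le> k1" "k1 \<le> l - 3" "k1 \<le> k" "k - k1 \<le> n - (l - 1)"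
    using k l ln by (auto simp: k1_def)
  define s where "s = l - 1 + (k - k1)"
  have s: "l - 1 \<le> s" "s \<le> n" using k1 ln by (auto simp: s_def)
  obtain E G where E: "E \<in> carrier_mat s n" and G: "G \<in> carrier_mat n s"
    and EG: "E * G = 1\<^sub>m s" and rows: "\<And>i. i < l - 1 \<Longrightarrow> row E i = row E0 i"
    using extend_right_inverse[OF E0 G0 EG0 s] by blast
  have rowE: "row E i \<bullet> x = f \<bullet> (A ^\<^sub>m i *\<^sub>v x)" if "i \<le> l - 2" "x \<in> carrier_vec n" for i x
    using row0[OF that] rows[of i] that(1) l by simp
  have biorth: "row E i \<bullet> col G j = (if i = j then 1 else 0)" if "i < s" "j < s" for i j
    using arg_cong[OF EG, of "\<lambda>M. M $$ (i, j)"] that E G by simp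
  \<comment> \<open>Since l is prime, the middle binomial coefficients vanish in the field; the term
    j = l vanishes because l > l - 2.\<close>
  have period: "f \<bullet> (A ^\<^sub>m l *\<^sub>v x) = f \<bullet> x" if x: "x \<in> carrier_vec n" for x
  proof -
    have "f \<bullet> (A ^\<^sub>m l *\<^sub>v x) = (\<Sum>j\<le>l. of_nat (l choose j) * (f \<bullet> ((A - 1\<^sub>m n) ^\<^sub>m j *\<^sub>v x)))"
      by (rule binomial_pow_mat_functional[OF A f x])
    also have "\<dots> = (\<Sum>j\<in>{0}. of_nat (l choose j) * (f \<bullet> ((A - 1\<^sub>m n) ^\<^sub>m j *\<^sub>v x)))"
    proof (intro sum.mono_neutral_right ballI)
      fix j assume "j \<in> {..l} - {0}"
      then have "j \<noteq> 0" "j < l \<or> j = l" by auto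
      then show "of_nat (l choose j) * (f \<bullet> ((A - 1\<^sub>m n) ^\<^sub>m j *\<^sub>v x)) = 0"
        using dvd_choose_prime[of j l] prime l zero[OF _ x, of l] CH of_nat_eq_0_iff_char_dvd[where 'a = 'a]
        by auto
    qed auto
    finally show ?thesis using A x by simp
  qed
  \<comment> \<open>The rows of E to be wedged: f A, ..., f A^k1, then the extra functionals, which
    start at index l - 1. Row 0 and rows k1 + 1, ..., l - 2 are left out, so they kill all chosen
    dual vectors.\<close>
  define e where "e a = (if a < k1 then Suc a else l - 1 + (a - k1))" for a
  have e: "e a < s" "e a \<noteq> 0" "\<And>q. k1 < q \<Longrightarrow> q < l - 1 \<Longrightarrow> e a \<noteq> q" if "a < k" for a
    using that k1 l by (auto simp: e_def s_def)
  have e_inj: "e a = e b \<longleftrightarrow> a = b" for a b using k1 l by (auto simp: e_def)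
  define F where "F = mat k n (\<lambda>(a, c). E $$ (e a, c))"
  define H where "H = mat n k (\<lambda>(c, b). G $$ (c, e b))"
  have F: "F \<in> carrier_mat k n" and H: "H \<in> carrier_mat n k" by (auto simp: F_def H_def)
  have rowF: "row F a = row E (e a)" if "a < k" for a
    using that E e[OF that] by (intro eq_vecI) (auto simp: F_def)
  have colH: "col H b = col G (e b)" if "b < k" for b
    using that G e[OF that] by (intro eq_vecI) (auto simp: H_def)
  have FH: "F * H = 1\<^sub>m k"
    by (rule eq_matI) (use F H e in \<open>auto simp: rowF colH biorth e_inj\<close>)
  \<comment> \<open>The exponents i + 1, ..., i + k1 are consecutive. If the largest is at most l -
    2, it serves. If it is l - 1, its predecessor l - 2 serves, being above k1 as k1 <= l - 3. If it
    is at least l, the exponent l itself occurs, because i < l.\<close>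
  have shift: "\<exists>a<k1. (k1 < Suc a + i \<and> Suc a + i < l - 1) \<or> Suc a + i = l"
    if "1 \<le> i" "i \<le> l - 1" for i
  proof -
    consider "k1 + i \<le> l - 2" | "k1 + i = l - 1" | "l \<le> k1 + i" by linarith
    then show ?thesis
    proof cases
      case 1 then show ?thesis using that k1 l by (intro exI[of _ "k1 - 1"]) auto
    next
      case 2 then show ?thesis using that k1 l by (intro exI[of _ "k1 - 2"]) auto
    next
      case 3 then show ?thesis using that k1 l by (intro exI[of _ "l - i - 1"]) auto
    qed
  qed
  have detFH: "det (F * (A ^\<^sub>m i * H)) = 0" if i: "1 \<le> i" "i \<le> l - 1" for i
  proof -
    obtain a where a: "a < k1" "(k1 < Suc a + i \<and> Suc a + i < l - 1) \<or> Suc a + i = l"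
      using shift[OF i] by blast
    have AH: "A ^\<^sub>m i * H \<in> carrier_mat n k" by (rule mult_carrier_mat[OF pow_carrier_mat[OF A] H])
    have entry: "(F * (A ^\<^sub>m i * H)) $$ (a, b) = 0" if b: "b < k" for b
    proof -
      let ?g = "col G (e b)"
      have g: "?g \<in> carrier_vec n" using G e[OF b] by auto
      have Ag: "A ^\<^sub>m i *\<^sub>v ?g \<in> carrier_vec n" by (rule mult_mat_vec_carrier[OF pow_carrier_mat[OF A] g])
      have "(F * (A ^\<^sub>m i * H)) $$ (a, b) = row E (Suc a) \<bullet> col (A ^\<^sub>m i * H) b"
        using a(1) b k1(3) F H A rowF[of a] by (simp add: e_def)
      also have "col (A ^\<^sub>m i * H) b = A ^\<^sub>m i *\<^sub>v ?g"
        using col_mult2[OF pow_carrier_mat[OF A] H b] colH[OF b] by simp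
      also have "row E (Suc a) \<bullet> (A ^\<^sub>m i *\<^sub>v ?g) = f \<bullet> (A ^\<^sub>m (Suc a + i) *\<^sub>v ?g)"
        using rowE[OF _ Ag, of "Suc a"] a(1) k1 l pow_mat_add_mult_vec[OF A g, of "Suc a" i] by simp
      also have "\<dots> = 0"
      proof (cases "Suc a + i = l")
        \<comment> \<open>By \<open>period\<close>, f A^l is f, which is row 0 of E, and e never
          takes the value 0.\<close>
        case True
        have "f \<bullet> (A ^\<^sub>m l *\<^sub>v ?g) = row E 0 \<bullet> ?g"
          using period[OF g] rowE[OF _ g, of 0] A g by simp
        then show ?thesis using True biorth[of 0 "e b"] e[OF b] by auto
      next
        case False
        then have q: "k1 < Suc a + i" "Suc a + i < l - 1" using a by auto
        then have "f \<bullet> (A ^\<^sub>m (Suc a + i) *\<^sub>v ?g) = row E (Suc a + i) \<bullet> ?g"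
          using rowE[OF _ g, of "Suc a + i"] by simp
        then show ?thesis using biorth[of "Suc a + i" "e b"] e(1)[OF b] e(3)[OF b q] q s by auto
      qed
      finally show ?thesis .
    qed
    \<comment> \<open>Row a of the matrix vanishes; it is displayed as an explicit zero row to match
      \<open>det_row_0\<close>.\<close>
    have "a < k" using a k1 by simp
    then have "F * (A ^\<^sub>m i * H) = mat\<^sub>r k k (\<lambda>r. if r = a then 0\<^sub>v k else row (F * (A ^\<^sub>m i * H)) r)"
      using F AH entry by (intro eq_matI) auto
    also have "det \<dots> = 0"
      by (rule det_row_0[OF \<open>a < k\<close>]) (use A H in \<open>auto intro!: carrier_vecI\<close>)
    finally show ?thesis .
  qed
  let ?u = "minors_vec n k (transpose_mat F)" and ?w = "minors_vec n k H"
  have uX: "?u \<bullet> (ext_power k A ^\<^sub>m i *\<^sub>v ?w) = det (F * (A ^\<^sub>m i * H))" for i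
    using minors_vec_scalar_prod[OF F mult_carrier_mat[OF pow_carrier_mat[OF A] H]]
    by (simp add: ext_power_pow_mult_minors_vec[OF A H])
  \<comment> \<open>proof (rule minus_one_pow_nonzero The sequence u . X^i w is 1 at i = 0 and 0 for
    1 <= i <= l - 1, so its difference of order l - 1 at 0 is nonzero.\<close>
  show ?thesis
  proof (rule minus_one_pow_nonzero[OF ext_power_carrier[OF A]])
    show "?u \<in> carrier_vec (length (k_subsets n k))" "?w \<in> carrier_vec (length (k_subsets n k))"
      by (simp_all add: minors_vec_def)
    show "?u \<bullet> ?w \<noteq> 0" using minors_vec_scalar_prod[OF F H] FH by simp
    show "?u \<bullet> (ext_power k A ^\<^sub>m j *\<^sub>v ?w) = 0" if "1 \<le> j" "j \<le> l - 1" for j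
      using uX detFH[OF that] by simp
  qed
qed

theorem theorem3p11:
  fixes A :: "'a::field mat" and n k l :: nat
  assumes "CHAR('a) = l" and "l \<ge> 5"
    and "A \<in> carrier_mat n n"
    and "unipotent_mat A"
    and "2 \<le> k" and "k \<le> n - 2"
    and "(A - 1\<^sub>m n) ^\<^sub>m (l - 2) \<noteq> 0\<^sub>m n n"
  shows "(ext_power k A - 1\<^sub>m (dim_row (ext_power k A))) ^\<^sub>m (l - 1)
           \<noteq> 0\<^sub>m (dim_row (ext_power k A)) (dim_row (ext_power k A))"
proof -
  have N: "A - 1\<^sub>m n \<in> carrier_mat n n" by (intro minus_carrier_mat one_carrier_mat)
  obtain r where "(A - 1\<^sub>m n) ^\<^sub>m r = 0\<^sub>m n n"
    using assms(3,4) by (auto simp: unipotent_mat_def)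
  from nilpotent_functional[OF N this assms(7)] obtain f v
    where "f \<in> carrier_vec n" "v \<in> carrier_vec n" "f \<bullet> ((A - 1\<^sub>m n) ^\<^sub>m (l - 2) *\<^sub>v v) = 1"
      "\<And>j x. l - 2 < j \<Longrightarrow> x \<in> carrier_vec n \<Longrightarrow> f \<bullet> ((A - 1\<^sub>m n) ^\<^sub>m j *\<^sub>v x) = 0"
    by blast
  from ext_power_unipotent_pow_nonzero[OF assms(1-3,5,6) this]
  show ?thesis using ext_power_carrier[OF assms(3), of k] by simp
qed

end
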